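(* Let $q>2$ and $n\ge1$ be integers, $h\in\{0,\ldots,n\}$, and $\lambda=(q-1)n-qh$. Suppose that $$\sum_{i=0}^{k} r^k_{i,h-k}\,P^{(q-1)}_i(l;k)\neq 0\qquad\text{for all } k=0,\ldots,h \text{ and } l=0,\ldots,k.$$ Then for every function $\varphi:W_h\to\mathbb{C}$, a $\lambda$-function $f$ with $f(\alpha)=\varphi(\alpha)$ for all $\alpha\in W_h$ is uniquely determined by $\varphi$; that is, if $f,g$ are $\lambda$-functions with $f=g$ on $W_h$, then $f=g$ on all of $\mathbf{F}_q^n$.
   Context: $\mathbf{F}_q=\{0,\ldots,q-1\}$ is the additive group of integers mod $q$; $\mathbf{F}_q^n$ is the vertex set of the $q$-ary Hamming graph (adjacency: differing in exactly one coordinate). $\rho$ is Hamming distance, $W_h=\{\alpha:\rho(\alpha,\mathbf{0})=h\}$, $W_1(\alpha)=\{\beta:\rho(\alpha,\beta)=1\}$. A $\lambda$-function is $f:\mathbf{F}_q^n\to\mathbb{C}$ with $\sum_{\beta\in W_1(\alpha)}f(\beta)=\lambda f(\alpha)$ for all $\alpha$. For $p\ge2$, $P^{(p)}_i(t;N)=\sum_{s=0}^{i}(-1)^s(p-1)^{i-s}\binom{t}{s}\binom{N-t}{i-s}$ (Krawtchouk polynomial); binomials with $b<0$ or $b>a\ge0$ are $0$ and empty sums are $0$. For $0\le k\le h$ and integers $i\ge0$, $0\le j\le n-k$, the coefficients $r^k_{ij}$ are: if $k\le n-h$, $r^k_{ij}=(-1)^i\sum_{l=0}^{j-i}P^{(q)}_{j-i-l}(h-k;n-2k)(q-2)^l\binom{k-i}{l}$;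 if $k>n-h$, let $U=(u_{ab})_{a,b=0}^{n-k}$ with $u_{ab}=(q-1)^{a-b}\binom{h+k-n}{a-b}$ (lower triangular, unit diagonal), $U^{-1}=(u'_{ab})$, and $r^k_{ij}=(-1)^i\sum_{s=i}^{j}u'_{js}P^{(q-1)}_{s-i}(h-k;h-i)$. (In both cases $r^k_{ij}=0$ for $i>j$.) *)

theory Defs
  imports "HOL-Library.FuncSet" "Jordan_Normal_Form.Gauss_Jordan_Elimination"
    "Jordan_Normal_Form.Determinant"
begin

(* A vertex is an extensional function on the coordinate set {..<n} with values in {..<q}.
   Only the element 0 of the group of integers mod q is used below. *)
definition hamming_vertices :: "nat \<Rightarrow> nat \<Rightarrow> (nat \<Rightarrow> nat) set" where
  "hamming_vertices q n = {..<n} \<rightarrow>\<^sub>E {..<q}"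

definition zero_vertex :: "nat \<Rightarrow> nat \<Rightarrow> nat" where
  "zero_vertex n = (\<lambda>i\<in>{..<n}. 0)"

definition hamming_dist :: "nat \<Rightarrow> (nat \<Rightarrow> nat) \<Rightarrow> (nat \<Rightarrow> nat) \<Rightarrow> nat" where
  "hamming_dist n \<alpha> \<beta> = card {i. i < n \<and> \<alpha> i \<noteq> \<beta> i}"

definition hamming_sphere :: "nat \<Rightarrow> nat \<Rightarrow> (nat \<Rightarrow> nat) \<Rightarrow> nat \<Rightarrow> (nat \<Rightarrow> nat) set" where
  "hamming_sphere q n \<alpha> d = {\<beta> \<in> hamming_vertices q n. hamming_dist n \<alpha> \<beta> = d}"

(* Values of f outside the vertex set are irrelevant; the zero function is allowed. *)
definition lambda_function :: "nat \<Rightarrow> nat \<Rightarrow> complex \<Rightarrow> ((nat \<Rightarrow> nat) \<Rightarrow> complex) \<Rightarrow> bool" where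
  "lambda_function q n ev f \<longleftrightarrow>
     (\<forall>\<alpha> \<in> hamming_vertices q n. (\<Sum>\<beta> \<in> hamming_sphere q n \<alpha> 1. f \<beta>) = ev * f \<alpha>)"

(* krawtchouk p i t N is the value at t of the degree i polynomial with parameters p and N.
   At natural numbers a, the generalized binomial a gchoose b agrees with a choose b,
   so it is 0 for b > a. *)
definition krawtchouk :: "nat \<Rightarrow> nat \<Rightarrow> real \<Rightarrow> real \<Rightarrow> real" where
  "krawtchouk p i t N =
     (\<Sum>s = 0..i. (- 1) ^ s * (real p - 1) ^ (i - s) * (t gchoose s) * ((N - t) gchoose (i - s)))"

definition U_mat :: "nat \<Rightarrow> nat \<Rightarrow> nat \<Rightarrow> nat \<Rightarrow> real mat" where
  "U_mat q n h k = mat (n - k + 1) (n - k + 1)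
     (\<lambda>(a, b). if b \<le> a then (real q - 1) ^ (a - b) * real ((h + k - n) choose (a - b)) else 0)"

lemma U_mat_invertible:
  "\<exists>V. mat_inverse (U_mat q n h k) = Some V \<and> V \<in> carrier_mat (n - k + 1) (n - k + 1) \<and>
     U_mat q n h k * V = 1\<^sub>m (n - k + 1) \<and> V * U_mat q n h k = 1\<^sub>m (n - k + 1)"
proof -
  let ?m = "n - k + 1"
  have c: "U_mat q n h k \<in> carrier_mat ?m ?m"
    by (simp add: U_mat_def)
  have "det (U_mat q n h k) = prod_list (diag_mat (U_mat q n h k))"
    by (rule det_lower_triangular[OF _ c]) (simp add: U_mat_def)
  also have "diag_mat (U_mat q n h k) = map (\<lambda>i. 1) [0..<?m]"
    unfolding diag_mat_def by (rule map_cong) (auto simp: U_mat_def)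
  also have "prod_list \<dots> = (1 :: real)"
    by (simp add: map_replicate_const)
  finally have "U_mat q n h k \<in> Units (ring_mat TYPE(real) ?m ())"
    using det_non_zero_imp_unit[OF c] by simp
  then show ?thesis
    using mat_inverse(1)[OF c, of "()"] mat_inverse(2)[OF c]
    by (cases "mat_inverse (U_mat q n h k)") auto
qed

(* Intended for k \<le> h \<le> n and j \<le> n - k. The index set {l. i + l \<le> j} of the first sum
   stands for l = 0, ..., j - i, which is empty if i > j. *)
definition r_coeff :: "nat \<Rightarrow> nat \<Rightarrow> nat \<Rightarrow> nat \<Rightarrow> nat \<Rightarrow> nat \<Rightarrow> real" where
  "r_coeff q n h k i j =
     (if k \<le> n - h then
        (- 1) ^ i * (\<Sum>l | i + l \<le> j.
           krawtchouk q (j - i - l) (real h - real k) (real n - 2 * real k) *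
           (real q - 2) ^ l * ((real k - real i) gchoose l))
      else
        (- 1) ^ i * (\<Sum>s = i..j.
           the (mat_inverse (U_mat q n h k)) $$ (j, s) *
           krawtchouk (q - 1) (s - i) (real h - real k) (real h - real i)))"

end

theory Submission
  imports Defs "HOL-Computational_Algebra.Formal_Power_Series"
begin

text \<open>
  Let \<open>d = f - g\<close>, a \<open>\<lambda>\<close>-function vanishing on \<open>W\<^sub>h\<close>. By induction on the weight, it suffices to treat a set
  \<open>I\<close> of \<open>k\<close> coordinates such that \<open>d\<close> vanishes on all vertices of weight less than \<open>k\<close>. For \<open>\<alpha>\<close> with
  support \<open>I\<close>, sum \<open>d\<close> over the vertices that agree with \<open>\<alpha>\<close> on \<open>I\<close> and have \<open>j\<close> nonzero coordinates
  outside \<open>I\<close>. Since the adjacency matrix is the sum of its parts inside and outside \<open>I\<close>, these sums satisfy a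
  three-term recurrence in \<open>j\<close>, which is also satisfied by the coefficients of
  \<open>(-z)\<^sup>i (1-z)\<^sup>h\<^sup>-\<^sup>k (1+(q-2)z)\<^sup>k\<^sup>-\<^sup>i (1+(q-1)z)\<^sup>n\<^sup>-\<^sup>h\<^sup>-\<^sup>k\<close>, the generating function of \<open>r\<^sup>k\<^sub>i\<^sub>j\<close>. Hence they equal
  \<open>\<Sum>i. r\<^sup>k\<^sub>i\<^sub>j A\<^sub>i d\<close> with \<open>A\<^sub>i\<close> the distance-\<open>i\<close> matrix of the face of \<open>I\<close>.
  If \<open>k \<le> h\<close>, they vanish for \<open>j = h - k\<close>; on the vertices of full support in \<open>I\<close>, a Hamming graph with
  alphabet size \<open>q - 1\<close>, the hypothesis says that the operator has no zero eigenvalue, so \<open>d = 0\<close> there.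
  If \<open>k > h\<close>, project \<open>d\<close> to the functions of zero sum in every direction of \<open>I\<close>: the projection has to be zero,
  since its eigenvalue in the directions outside \<open>I\<close> is too large, and the projector restricted to full
  support is invertible.
\<close>

section \<open>Generating functions of the coefficients\<close>

text \<open>The binomial series (1 + c z)^a. Real exponents are allowed because k - i and n - h - k
  below may be negative.\<close>

definition binom_fps :: "real \<Rightarrow> real \<Rightarrow> real fps" where
  "binom_fps c a = Abs_fps (\<lambda>m. c ^ m * (a gchoose m))"

lemma binom_fps_nth [simp]: "fps_nth (binom_fps c a) m = c ^ m * (a gchoose m)"
  by (simp add: binom_fps_def)

lemma binom_fps_0 [simp]: "binom_fps c 0 = 1"
  by (rule fps_ext) (simp add: gbinomial_0_left)

lemma binom_fps_plus_1: "binom_fps c (a + 1) = (1 + fps_const c * fps_X) * binom_fps c a"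
proof (rule fps_ext)
  fix m
  show "fps_nth (binom_fps c (a + 1)) m = fps_nth ((1 + fps_const c * fps_X) * binom_fps c a) m"
  proof (cases m)
    case (Suc m')
    then show ?thesis
      using gbinomial_Suc_Suc[of a m'] by (simp add: distrib_right distrib_left mult.assoc)
  qed simp
qed

lemma fps_deriv_binom_fps:
  "fps_deriv (binom_fps c a) = fps_const (a * c) * binom_fps c (a - 1)"
proof (rule fps_ext)
  fix m
  have "real (Suc m) * (a gchoose Suc m) = a * (a - 1 gchoose m)"
    using gbinomial_absorption[of m "a"] by simp
  then show "fps_nth (fps_deriv (binom_fps c a)) m =
      fps_nth (fps_const (a * c) * binom_fps c (a - 1)) m"
    by (simp del: of_nat_Suc add: mult_ac)
qed

lemma binom_fps_add: "binom_fps c (a + b) = binom_fps c a * binom_fps c b"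
proof (rule fps_ext)
  fix m
  have "fps_nth (binom_fps c a * binom_fps c b) m =
      (\<Sum>k\<le>m. c ^ m * ((a gchoose k) * (b gchoose (m - k))))"
    unfolding fps_mult_nth atMost_atLeast0[symmetric]
  proof (rule sum.cong[OF refl])
    fix k assume "k \<in> {..m}"
    then have "c ^ m = c ^ k * c ^ (m - k)"
      by (simp flip: power_add)
    then show "fps_nth (binom_fps c a) k * fps_nth (binom_fps c b) (m - k) =
        c ^ m * ((a gchoose k) * (b gchoose (m - k)))"
      by simp
  qed
  also have "\<dots> = c ^ m * ((a + b) gchoose m)"
    by (simp add: gbinomial_Vandermonde[symmetric] atMost_atLeast0 flip: sum_distrib_left)
  finally show "fps_nth (binom_fps c (a + b)) m = fps_nth (binom_fps c a * binom_fps c b) m"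
    by simp
qed

text \<open>The Cauchy product gives the generating function (1 - z)^t (1 + (p-1) z)^(N-t). Raising
  N by 1 multiplies it by 1 + (p-1) z; raising both t and N multiplies it by 1 - z.\<close>

lemma krawtchouk_conv_fps:
  "krawtchouk p i t N = fps_nth (binom_fps (- 1) t * binom_fps (real p - 1) (N - t)) i"
  unfolding krawtchouk_def fps_mult_nth by (rule sum.cong) auto

lemma krawtchouk_0 [simp]: "krawtchouk p 0 t N = 1"
  by (simp add: krawtchouk_def)

lemma krawtchouk_Suc_N:
  "krawtchouk p (Suc i) t (N + 1) = krawtchouk p (Suc i) t N + (real p - 1) * krawtchouk p i t N"
proof -
  have e: "N + 1 - t = (N - t) + 1" by simp
  show ?thesis
    unfolding krawtchouk_conv_fps e binom_fps_plus_1 mult.left_commute[of _ "1 + _"]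
    by (simp add: distrib_right mult.assoc del: binom_fps_nth)
qed

lemma krawtchouk_Suc_both:
  "krawtchouk p (Suc i) (t + 1) (N + 1) = krawtchouk p (Suc i) t N - krawtchouk p i t N"
proof -
  have e: "N + 1 - (t + 1) = N - t" by simp
  show ?thesis
    unfolding krawtchouk_conv_fps e binom_fps_plus_1
    by (simp add: algebra_simps del: binom_fps_nth)
qed

text \<open>One series serves both cases in the definition of \<open>r_coeff\<close>: the exponent n
  - h - k is negative exactly in the case where \<open>U_mat\<close> is inverted.\<close>

definition r_gf :: "nat \<Rightarrow> nat \<Rightarrow> nat \<Rightarrow> nat \<Rightarrow> nat \<Rightarrow> real fps" where
  "r_gf q n h k i = (- fps_X) ^ i *
     (binom_fps (- 1) (real h - real k) * binom_fps (real q - 2) (real k - real i) *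
      binom_fps (real q - 1) (real n - real h - real k))"

lemma fps_nth_minus_X_power_mult:
  "fps_nth ((- fps_X) ^ i * (F :: real fps)) j = (if j < i then 0 else (- 1) ^ i * fps_nth F (j - i))"
proof -
  have "(- fps_X) ^ i = (fps_const ((- 1) ^ i) * fps_X ^ i :: real fps)"
    by (induction i) (simp_all flip: fps_const_neg)
  then show ?thesis
    by (simp add: mult.assoc fps_X_power_mult_nth del: power_minus')
qed

text \<open>\<open>U_mat\<close> is the lower triangular Toeplitz matrix of the series (1 + (q-1)
  z)^(h+k-n). Such matrices multiply like their series, so the inverse matrix belongs to the
  reciprocal series.\<close>

lemma mat_inverse_U_mat:
  assumes "n < h + k" "j \<le> n - k" "s \<le> n - k"
  shows "the (mat_inverse (U_mat q n h k)) $$ (j, s) =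
    (if s \<le> j then fps_nth (binom_fps (real q - 1) (real n - real h - real k)) (j - s) else 0)"
proof -
  let ?m = "n - k + 1"
  let ?B = "binom_fps (real q - 1) (real n - real h - real k)"
  let ?C = "binom_fps (real q - 1) (real (h + k - n))"
  define W where "W = mat ?m ?m (\<lambda>(a, b). if b \<le> a then fps_nth ?B (a - b) else 0)"
  have U: "U_mat q n h k = mat ?m ?m (\<lambda>(a, b). if b \<le> a then fps_nth ?C (a - b) else 0)"
    unfolding U_mat_def by (rule eq_matI) (auto simp: binomial_gbinomial)
  have CB: "?C * ?B = 1"
    using assms(1) by (simp flip: binom_fps_add add: of_nat_diff)
  have UW: "U_mat q n h k * W = 1\<^sub>m ?m"
  proof (rule eq_matI)
    fix a b assume "a < dim_row (1\<^sub>m ?m :: real mat)" "b < dim_col (1\<^sub>m ?m :: real mat)"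
    then have ab: "a < ?m" "b < ?m" by auto
    have "(U_mat q n h k * W) $$ (a, b) = (\<Sum>i = 0..<?m.
        (if i \<le> a then fps_nth ?C (a - i) else 0) * (if b \<le> i then fps_nth ?B (i - b) else 0))"
      unfolding U W_def using ab by (simp add: scalar_prod_def del: binom_fps_nth)
    also have "\<dots> = (\<Sum>i = b..a. fps_nth ?C (a - i) * fps_nth ?B (i - b))"
      by (rule sum.mono_neutral_cong_right) (use ab in auto)
    also have "\<dots> = (if b \<le> a then fps_nth (?C * ?B) (a - b) else 0)"
    proof (cases "b \<le> a")
      case True
      have "(\<Sum>i = b..a. fps_nth ?C (a - i) * fps_nth ?B (i - b)) =
          (\<Sum>i = 0..a - b. fps_nth ?C i * fps_nth ?B (a - b - i))"
        by (rule sum.reindex_bij_witness[of _ "\<lambda>i. a - i" "\<lambda>i. a - i"]) (use True in auto)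
      then show ?thesis using True by (simp add: fps_mult_nth del: binom_fps_nth)
    qed auto
    also have "\<dots> = 1\<^sub>m ?m $$ (a, b)"
      unfolding CB using ab by auto
    finally show "(U_mat q n h k * W) $$ (a, b) = 1\<^sub>m ?m $$ (a, b)" .
  qed (auto simp: U W_def)
  obtain V where V: "mat_inverse (U_mat q n h k) = Some V" "V \<in> carrier_mat ?m ?m"
      "V * U_mat q n h k = 1\<^sub>m ?m"
    using U_mat_invertible by blast
  have carrier: "U_mat q n h k \<in> carrier_mat ?m ?m" "W \<in> carrier_mat ?m ?m"
    by (auto simp: U_mat_def W_def)
  have "V = V * (U_mat q n h k * W)"
    using V(2) by (simp add: UW)
  also have "\<dots> = W"
    using assoc_mult_mat[OF V(2) carrier] carrier(2) by (simp add: V(3))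
  finally have "V = W" .
  then show ?thesis
    using assms V by (simp add: W_def del: binom_fps_nth)
qed

text \<open>For k \<le> n - h, the Krawtchouk factor supplies the powers of 1 - z and 1 + (q-1) z,
  and the sum over l is the Cauchy product with the power of 1 + (q-2) z. Otherwise the Krawtchouk
  factor with parameter q - 1 supplies 1 - z and 1 + (q-2) z, and the inverse matrix supplies 1 +
  (q-1) z.\<close>

lemma r_coeff_conv_fps:
  assumes "k \<le> h" "h \<le> n" "q \<ge> 1" "j \<le> n - k"
  shows "r_coeff q n h k i j = fps_nth (r_gf q n h k i) j"
proof (cases "j < i")
  case True
  then show ?thesis
    by (simp add: r_coeff_def r_gf_def fps_nth_minus_X_power_mult)
next
  case ij: False
  let ?A = "binom_fps (- 1) (real h - real k)"
  let ?Y = "binom_fps (real q - 2) (real k - real i)"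
  let ?B = "binom_fps (real q - 1) (real n - real h - real k)"
  show ?thesis
  proof (cases "k \<le> n - h")
    case True
    have "{l. i + l \<le> j} = {0..j - i}"
      using ij by auto
    moreover have "real n - 2 * real k - (real h - real k) = real n - real h - real k"
      by simp
    moreover have "fps_nth (?A * ?Y * ?B) (j - i) =
        (\<Sum>l = 0..j - i. fps_nth (?A * ?B) (j - i - l) * (real q - 2) ^ l * (real k - real i gchoose l))"
    proof -
      have eq: "?A * ?Y * ?B = ?Y * (?A * ?B)"
        by (simp add: mult_ac)
      show ?thesis
        unfolding eq fps_mult_nth[of ?Y] binom_fps_nth by (rule sum.cong) (simp_all only: mult_ac)
    qed
    ultimately show ?thesis
      using True ij
      by (simp add: r_coeff_def r_gf_def fps_nth_minus_X_power_mult krawtchouk_conv_fps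
          del: binom_fps_nth)
  next
    case False
    have eq: "real h - real i - (real h - real k) = real k - real i" "real (q - 1) - 1 = real q - 2"
      using assms by (auto simp: of_nat_diff)
    have "(\<Sum>s = i..j. the (mat_inverse (U_mat q n h k)) $$ (j, s) *
           krawtchouk (q - 1) (s - i) (real h - real k) (real h - real i))
        = (\<Sum>s = i..j. fps_nth ?B (j - s) * fps_nth (?A * ?Y) (s - i))"
      unfolding krawtchouk_conv_fps eq
      by (rule sum.cong[OF refl]) (use False assms in \<open>auto simp: mat_inverse_U_mat simp del: binom_fps_nth\<close>)
    also have "\<dots> = (\<Sum>s = 0..j - i. fps_nth (?A * ?Y) s * fps_nth ?B (j - i - s))"
      by (rule sum.reindex_bij_witness[of _ "\<lambda>s. s + i" "\<lambda>s. s - i"]) (use ij in auto)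
    finally show ?thesis
      using False ij
      by (simp add: r_coeff_def r_gf_def fps_nth_minus_X_power_mult fps_mult_nth[of "?A * ?Y"]
          del: binom_fps_nth)
  qed
qed

section \<open>A differential equation for the generating functions\<close>

lemma r_gf_Suc: "r_gf q n h k (Suc i) * (1 + fps_const (real q - 2) * fps_X) = - fps_X * r_gf q n h k i"
proof -
  have "binom_fps (real q - 2) (real k - real i) =
      (1 + fps_const (real q - 2) * fps_X) * binom_fps (real q - 2) (real k - real (Suc i))"
    by (simp flip: binom_fps_plus_1)
  then show ?thesis
    by (simp add: r_gf_def mult_ac)
qed

text \<open>The algebraic core of \<open>r_gf_ode\<close>, by the product rule. Here z, l y, a, b
  stand for the four factors of the series and y' for the derivative of l y. The terms with i l and
  with k - i become -x i R(i-1) and -x (k-i) (c-1) R(i+1).\<close>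

lemma r_gf_ode_aux:
  fixes x z z' a a' b b' y y' c n k h i :: "'a::idom"
  assumes "x * z' = i * z" "(1 - x) * a' = (k - h) * a" "(1 + (c - 1) * x) * b' = (n - h - k) * (c - 1) * b"
    "y' = (k - i) * (c - 2) * y"
  defines "l \<equiv> 1 + (c - 2) * x"
  shows "x * ((1 - x) * (1 + (c - 1) * x) * (z' * ((l * y) * (a * b)) + z * (y' * (a * b) + l * y * (a' * b + a * b')))) =
    x * ((((c - 1) * n - c * h - i * (c - 2)) - (c - 1) * (n - k) * x) * (z * ((l * y) * (a * b))))
     + i * l * (z * ((l * y) * (a * b))) - x * ((k - i) * (c - 1) * (- x * z * (y * (a * b))))"
proof -
  let ?d = "1 + (c - 1) * x"
  have "x * ((1 - x) * ?d * (z' * ((l * y) * (a * b)) + z * (y' * (a * b) + l * y * (a' * b + a * b')))) =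
    (1 - x) * ?d * (x * z') * (l * y * (a * b)) + x * z * ((1 - x) * ?d * y' * (a * b)
      + l * y * (?d * b * ((1 - x) * a') + (1 - x) * a * (?d * b')))"
    by (simp add: distrib_left distrib_right mult_ac)
  then show ?thesis
    unfolding assms(1-4) by (simp add: l_def algebra_simps)
qed

text \<open>The logarithmic derivative of each factor has one simple pole. The polynomial on the
  left clears those of 1 - z and 1 + (q-1) z; the poles at 0 and at the zero of 1 + (q-2) z are
  absorbed by R(i-1) and R(i+1).\<close>

lemma r_gf_ode:
  fixes q n h k i :: nat
  defines "R \<equiv> r_gf q n h k" and "p \<equiv> real q - 1"
  shows "(1 - fps_X) * (1 + fps_const p * fps_X) * fps_deriv (R i) =
    (fps_const (p * real n - real q * real h - real i * (real q - 2))
      - fps_const (p * (real n - real k)) * fps_X) * R i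
    - fps_const (real i) * R (i - 1) - fps_const ((real k - real i) * p) * R (Suc i)"
proof -
  define A where "A = binom_fps (- 1) (real h - real k)"
  define B where "B = binom_fps p (real n - real h - real k)"
  define Y where "Y = binom_fps (real q - 2) (real k - real (Suc i))"
  let ?X = "fps_X :: real fps"
  let ?l = "1 + fps_const (real q - 2) * ?X"
  have A': "(1 - ?X) * fps_deriv A = fps_const (real k - real h) * A"
  proof -
    have "A = (1 - ?X) * binom_fps (- 1) (real h - real k - 1)"
      unfolding A_def using binom_fps_plus_1[of "-1" "real h - real k - 1"] by (simp flip: fps_const_neg)
    then show ?thesis
      unfolding A_def fps_deriv_binom_fps by (simp add: mult_ac)
  qed
  have B': "(1 + fps_const p * ?X) * fps_deriv B = fps_const ((real n - real h - real k) * p) * B"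
  proof -
    have "B = (1 + fps_const p * ?X) * binom_fps p (real n - real h - real k - 1)"
      unfolding B_def using binom_fps_plus_1[of p "real n - real h - real k - 1"] by simp
    then show ?thesis
      unfolding B_def fps_deriv_binom_fps by (simp add: mult_ac)
  qed
  have Yi: "binom_fps (real q - 2) (real k - real i) = ?l * Y"
    by (simp add: Y_def flip: binom_fps_plus_1)
  have Yi': "fps_deriv (?l * Y) = fps_const ((real k - real i) * (real q - 2)) * Y"
    unfolding Yi[symmetric] fps_deriv_binom_fps by (simp add: Y_def algebra_simps)
  have Ri: "R i = (- ?X) ^ i * ((?l * Y) * (A * B))"
    unfolding R_def r_gf_def Yi A_def B_def p_def by (simp add: mult_ac)
  have RS: "R (Suc i) = (- ?X) * (- ?X) ^ i * (Y * (A * B))"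
    unfolding R_def r_gf_def Y_def A_def B_def p_def by (simp add: mult_ac)
  \<comment> \<open>Naming the constant series turns the claim into an identity of ring elements, to
    which \<open>r_gf_ode_aux\<close> applies.\<close>
  define c where "c = fps_const (real q)"
  define N where "N = fps_const (real n)"
  define K where "K = fps_const (real k)"
  define H where "H = fps_const (real h)"
  define I where "I = fps_const (real i)"
  have const_eqs: "fps_const p = c - 1" "fps_const (real q - 2) = c - 2"
      "fps_const ((real k - real i) * p) = (K - I) * (c - 1)"
      "fps_const ((real k - real i) * (real q - 2)) = (K - I) * (c - 2)"
      "fps_const (real k - real h) = K - H"
      "fps_const ((real n - real h - real k) * p) = (N - H - K) * (c - 1)"
      "fps_const (p * real n - real q * real h - real i * (real q - 2)) = (c - 1) * N - c * H - I * (c - 2)"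
      "fps_const (p * (real n - real k)) = (c - 1) * (N - K)"
      "fps_const (real i) = I"
    by (simp_all add: c_def p_def N_def K_def H_def I_def numeral_fps_const
        flip: fps_const_sub fps_const_mult fps_const_1_eq_1)
  have Z': "?X * fps_deriv ((- ?X) ^ i) = I * (- ?X) ^ i"
    unfolding I_def
  proof (induction i)
    case (Suc i)
    have "?X * fps_deriv ((- ?X) ^ Suc i) = - ?X * (- ?X) ^ i - ?X * (?X * fps_deriv ((- ?X) ^ i))"
      by (simp add: algebra_simps del: fps_deriv_power power_minus')
    also have "\<dots> = - ?X * (- ?X) ^ i * (fps_const (real i) + 1)"
      unfolding Suc.IH by (simp add: algebra_simps)
    also have "fps_const (real i) + 1 = fps_const (real (Suc i))"
      by (simp add: add.commute flip: fps_const_1_eq_1)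
    finally show ?case by (simp add: mult_ac)
  qed simp
  \<comment> \<open>With the factors z and i in front, \<open>r_gf_Suc\<close> expresses R(i-1)
    through R(i) without division, and i = 0 is covered.\<close>
  have Rm: "I * (?X * R (i - 1)) = - (I * ?l * R i)"
  proof (cases i)
    case 0
    then show ?thesis by (simp add: I_def)
  next
    case (Suc m)
    then show ?thesis
      using r_gf_Suc[of q n h k m] by (simp add: R_def mult_ac)
  qed
  \<comment> \<open>The equation is proved after multiplication by z, which is cancelled at the
    end.\<close>
  have "?X * ((1 - ?X) * (1 + fps_const p * ?X) * fps_deriv (R i)) =
    ?X * (((((c - 1) * N - c * H - I * (c - 2)) - (c - 1) * (N - K) * ?X) * R i)
    - I * R (i - 1) - (K - I) * (c - 1) * R (Suc i))"
    (is "?lhs = ?X * (?U - I * R (i - 1) - ?V)")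
  proof -
    have D: "fps_deriv (R i) = fps_deriv ((- ?X) ^ i) * ((?l * Y) * (A * B)) +
      (- ?X) ^ i * (fps_deriv (?l * Y) * (A * B) + ?l * Y * (fps_deriv A * B + A * fps_deriv B))"
      unfolding Ri fps_deriv_mult by (simp only: add_ac)
    have "?lhs = ?X * ?U + I * ?l * R i - ?X * ?V"
      unfolding D unfolding Ri RS const_eqs
      using r_gf_ode_aux[OF Z' A'[unfolded const_eqs] B'[unfolded const_eqs] Yi'[unfolded const_eqs]]
      unfolding const_eqs by (simp del: fps_deriv_mult)
    also have "I * ?l * R i = - (?X * (I * R (i - 1)))"
      using Rm by (simp add: mult_ac)
    finally show ?thesis by (simp add: right_diff_distrib)
  qed
  then show ?thesis
    unfolding const_eqs by simp
qed

text \<open>The recurrence is the coefficient of \<open>z ^ j\<close> in the differential equation for \<open>r_gf\<close>.\<close>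

lemma r_gf_recurrence:
  fixes q n h k i j :: nat
  defines "r \<equiv> \<lambda>i j. fps_nth (r_gf q n h k i) j"
  shows "real (Suc j) * r i (Suc j) =
    ((real q - 1) * real n - real q * real h - real j * (real q - 2)) * r i j
    - (real i * r (i - 1) j + real i * (real q - 2) * r i j + (real k - real i) * (real q - 1) * r (Suc i) j)
    - (if j = 0 then 0 else (real n - real k - real (j - 1)) * (real q - 1) * r i (j - 1))"
proof -
  let ?D = "fps_deriv (r_gf q n h k i)"
  have lhs: "(1 - fps_X) * (1 + fps_const (real q - 1) * fps_X) * ?D =
      ?D + fps_X * (fps_const (real q - 2) * ?D) - fps_X * (fps_X * (fps_const (real q - 1) * ?D))"
    by (simp add: algebra_simps numeral_fps_const flip: fps_const_sub fps_const_1_eq_1)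
  have rhs: "(fps_const a - fps_const b * fps_X) * F = fps_const a * F - fps_X * (fps_const b * F)"
    for a b and F :: "real fps"
    by (simp add: algebra_simps)
  note eq = arg_cong[OF r_gf_ode[of q n h k i, unfolded lhs rhs], of "\<lambda>F. fps_nth F j"]
  \<comment> \<open>The left side involves the coefficients j, j - 1 and j - 2 of the derivative, so
    j = 0 and j = 1 are boundary cases.\<close>
  show ?thesis
  proof (cases j)
    case 0
    then show ?thesis
      using eq by (simp add: r_def algebra_simps)
  next
    case (Suc m)
    show ?thesis
    proof (cases m)
      case 0
      then show ?thesis
        using eq Suc by (simp add: r_def algebra_simps)
    next
      case (Suc l)
      then show ?thesis
        using eq \<open>j = Suc m\<close> by (simp add: r_def algebra_simps)
    qed
  qed
qed

section \<open>Operators in the Bose-Mesner algebra of the Hamming scheme\<close>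

definition coord_dist :: "'a set \<Rightarrow> ('a \<Rightarrow> 'b) \<Rightarrow> ('a \<Rightarrow> 'b) \<Rightarrow> nat" where
  "coord_dist I x y = card {i \<in> I. x i \<noteq> y i}"

lemma coord_dist_insert:
  assumes "finite I" "c \<notin> I"
  shows "coord_dist (insert c I) x y = (if x c = y c then coord_dist I x y else Suc (coord_dist I x y))"
proof -
  have "{i \<in> insert c I. x i \<noteq> y i} =
      (if x c = y c then {i \<in> I. x i \<noteq> y i} else insert c {i \<in> I. x i \<noteq> y i})"
    by auto
  then show ?thesis
    using assms by (simp add: coord_dist_def)
qed

lemma coord_dist_cong:
  "(\<And>i. i \<in> I \<Longrightarrow> x i = x' i) \<Longrightarrow> (\<And>i. i \<in> I \<Longrightarrow> y i = y' i) \<Longrightarrow> coord_dist I x y = coord_dist I x' y'"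
  unfolding coord_dist_def by (metis (mono_tags, lifting))

lemma coord_dist_commute: "coord_dist I x y = coord_dist I y x"
  by (simp add: coord_dist_def eq_commute)

lemma coord_dist_le: "finite I \<Longrightarrow> coord_dist I x y \<le> card I"
  unfolding coord_dist_def by (rule card_mono) auto

lemma sum_PiE_insert:
  assumes "c \<notin> I"
  shows "(\<Sum>x \<in> PiE (insert c I) B. g x) = (\<Sum>v \<in> B c. \<Sum>x \<in> PiE I B. g (x(c := v)))"
proof -
  have "(\<Sum>x \<in> PiE (insert c I) B. g x) = (\<Sum>(v, x) \<in> B c \<times> PiE I B. g (x(c := v)))"
    unfolding PiE_insert_eq using inj_combinator[OF assms, of B]
    by (subst sum.reindex) (auto simp: case_prod_unfold)
  then show ?thesis
    by (simp add: sum.cartesian_product)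
qed

text \<open>On the Hamming graph with alphabet of size \<open>p\<close>, the eigenvalues of \<open>\<Sum>i. c i *\<close> (distance-\<open>i\<close>
  matrix) are the numbers \<open>\<Sum>i. c i * krawtchouk p i l k\<close>.\<close>

definition hamming_eigenvalue :: "nat \<Rightarrow> (nat \<Rightarrow> real) \<Rightarrow> nat \<Rightarrow> nat \<Rightarrow> real" where
  "hamming_eigenvalue p c l k = (\<Sum>i = 0..k. c i * krawtchouk p i (real l) (real k))"

lemma krawtchouk_eq_0:
  assumes "l \<le> k" "k < i"
  shows "krawtchouk p i (real l) (real k) = 0"
  unfolding krawtchouk_def
proof (rule sum.neutral, rule ballI)
  fix s assume "s \<in> {0..i}"
  \<comment> \<open>Since s + (i - s) > l + (k - l), one lower index exceeds its upper one.\<close>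
  then have "l choose s = 0 \<or> (k - l) choose (i - s) = 0"
    using assms by (auto simp: binomial_eq_0_iff)
  then have "(real l gchoose s) = 0 \<or> (real k - real l gchoose (i - s)) = 0"
    using assms by (simp flip: of_nat_diff add: binomial_gbinomial[symmetric] del: binomial_eq_0_iff)
  then show "(- 1) ^ s * (real p - 1) ^ (i - s) * (real l gchoose s) * (real k - real l gchoose (i - s)) = 0"
    by auto
qed

text \<open>This corresponds to functions constant in an added coordinate: one value there keeps the
  distance and p - 1 values raise it.\<close>

lemma hamming_eigenvalue_Suc:
  assumes "l \<le> k"
  shows "hamming_eigenvalue p c l (Suc k) = hamming_eigenvalue p (\<lambda>i. c i + (real p - 1) * c (Suc i)) l k"
proof -
  have "hamming_eigenvalue p c l (Suc k) = c 0 + (\<Sum>i = 0..k. c (Suc i) * krawtchouk p (Suc i) (real l) (real k + 1))"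
    unfolding hamming_eigenvalue_def sum.atLeast0_atMost_Suc_shift by (simp add: add.commute)
  also have "\<dots> = (c 0 + (\<Sum>i = 0..k. c (Suc i) * krawtchouk p (Suc i) (real l) (real k)))
      + (\<Sum>i = 0..k. (real p - 1) * c (Suc i) * krawtchouk p i (real l) (real k))"
    unfolding krawtchouk_Suc_N distrib_left sum.distrib by (simp add: mult_ac)
  also have "c 0 + (\<Sum>i = 0..k. c (Suc i) * krawtchouk p (Suc i) (real l) (real k)) =
      (\<Sum>i = 0..Suc k. c i * krawtchouk p i (real l) (real k))"
    by (simp only: sum.atLeast0_atMost_Suc_shift) simp
  also have "\<dots> = (\<Sum>i = 0..k. c i * krawtchouk p i (real l) (real k))"
    using krawtchouk_eq_0[OF assms, of "Suc k"] by simp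
  finally show ?thesis
    by (simp only: hamming_eigenvalue_def distrib_right sum.distrib)
qed

text \<open>This corresponds to functions of zero sum in an added coordinate: the p - 1 values that
  raise the distance together contribute the negative of the value that keeps it.\<close>

lemma hamming_eigenvalue_Suc_Suc:
  assumes "l \<le> k"
  shows "hamming_eigenvalue p c (Suc l) (Suc k) = hamming_eigenvalue p (\<lambda>i. c i - c (Suc i)) l k"
proof -
  have "hamming_eigenvalue p c (Suc l) (Suc k) = c 0 + (\<Sum>i = 0..k. c (Suc i) * krawtchouk p (Suc i) (real l + 1) (real k + 1))"
    unfolding hamming_eigenvalue_def sum.atLeast0_atMost_Suc_shift by (simp add: add.commute)
  also have "\<dots> = (c 0 + (\<Sum>i = 0..k. c (Suc i) * krawtchouk p (Suc i) (real l) (real k)))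
      - (\<Sum>i = 0..k. c (Suc i) * krawtchouk p i (real l) (real k))"
    unfolding krawtchouk_Suc_both right_diff_distrib sum_subtractf by simp
  also have "c 0 + (\<Sum>i = 0..k. c (Suc i) * krawtchouk p (Suc i) (real l) (real k)) =
      (\<Sum>i = 0..Suc k. c i * krawtchouk p i (real l) (real k))"
    by (simp only: sum.atLeast0_atMost_Suc_shift) simp
  also have "\<dots> = (\<Sum>i = 0..k. c i * krawtchouk p i (real l) (real k))"
    using krawtchouk_eq_0[OF assms, of "Suc k"] by simp
  finally show ?thesis
    by (simp add: hamming_eigenvalue_def algebra_simps sum_subtractf)
qed

text \<open>A kernel x^d is a product over the coordinates. Each recursion step keeps it geometric
  and splits off a factor 1 - x or 1 + (p-1) x.\<close>

lemma hamming_eigenvalue_geometric: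
  "l \<le> k \<Longrightarrow> hamming_eigenvalue p (\<lambda>i. a * x ^ i) l k = a * (1 - x) ^ l * (1 + (real p - 1) * x) ^ (k - l)"
proof (induction k arbitrary: a l)
  case 0
  then show ?case by (simp add: hamming_eigenvalue_def)
next
  case (Suc k)
  show ?case
  proof (cases l)
    case 0
    have "(\<lambda>i. a * x ^ i + (real p - 1) * (a * x ^ Suc i)) = (\<lambda>i. (a * (1 + (real p - 1) * x)) * x ^ i)"
      by (simp add: algebra_simps)
    then show ?thesis
      unfolding 0 hamming_eigenvalue_Suc[OF le0] by (simp add: Suc.IH)
  next
    case (Suc l')
    have "(\<lambda>i. a * x ^ i - a * x ^ Suc i) = (\<lambda>i. (a * (1 - x)) * x ^ i)"
      by (simp add: algebra_simps)
    moreover have "l' \<le> k"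
      using Suc.prems Suc by simp
    ultimately show ?thesis
      unfolding Suc hamming_eigenvalue_Suc_Suc[OF \<open>l' \<le> k\<close>] by (simp add: Suc.IH)
  qed
qed

text \<open>Induction on the number of coordinates: the sum of \<open>g\<close> over the last coordinate, and the difference of
  two values of \<open>g\<close> there, are annihilated by operators of the same kind in one coordinate less.\<close>

lemma hamming_operator_injective:
  fixes g :: "('a \<Rightarrow> 'b) \<Rightarrow> 'c::real_vector" and c :: "nat \<Rightarrow> real"
  assumes "finite I" "finite B"
    and "\<And>l. l \<le> card I \<Longrightarrow> hamming_eigenvalue (card B) c l (card I) \<noteq> 0"
    and "\<And>x. x \<in> I \<rightarrow>\<^sub>E B \<Longrightarrow> (\<Sum>y \<in> I \<rightarrow>\<^sub>E B. c (coord_dist I x y) *\<^sub>R g y) = 0"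
    and "x \<in> I \<rightarrow>\<^sub>E B"
  shows "g x = 0"
  using assms
proof (induction I arbitrary: c g x rule: finite_induct)
  case empty
  then have "c 0 \<noteq> 0"
    using empty(2)[of 0] by (simp add: hamming_eigenvalue_def)
  then show ?case
    using empty(3)[of x] empty(4) by (simp add: coord_dist_def)
next
  case (insert e I)
  let ?p = "card B"
  have ev: "hamming_eigenvalue ?p c l (Suc (card I)) \<noteq> 0" if "l \<le> Suc (card I)" for l
    using insert.prems(2)[of l] insert.hyps that by simp
  have upd: "z(e := v) \<in> insert e I \<rightarrow>\<^sub>E B" if "z \<in> I \<rightarrow>\<^sub>E B" "v \<in> B" for z v
    using that by (auto simp: PiE_def extensional_def)
  have dist: "coord_dist (insert e I) (x(e := v)) (y(e := w)) =
      (if v = w then coord_dist I x y else Suc (coord_dist I x y))" for x y :: "'a \<Rightarrow> 'b" and v w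
  proof -
    have "coord_dist I (x(e := v)) (y(e := w)) = coord_dist I x y"
      using insert.hyps by (intro coord_dist_cong) auto
    then show ?thesis
      using insert.hyps by (auto simp: coord_dist_insert)
  qed
  have "(\<Sum>w\<in>B. \<Sum>y \<in> I \<rightarrow>\<^sub>E B. c (if v = w then coord_dist I z y else Suc (coord_dist I z y)) *\<^sub>R g (y(e := w))) = 0"
    if "z \<in> I \<rightarrow>\<^sub>E B" "v \<in> B" for z v
    using insert.prems(3)[OF upd[OF that]] unfolding sum_PiE_insert[OF insert.hyps(2)] dist .
  then have eq: "(\<Sum>y \<in> I \<rightarrow>\<^sub>E B. \<Sum>w\<in>B. c (if v = w then coord_dist I z y else Suc (coord_dist I z y)) *\<^sub>R g (y(e := w))) = 0"
    if "z \<in> I \<rightarrow>\<^sub>E B" "v \<in> B" for z v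
    using that by (subst sum.swap) auto
  \<comment> \<open>In the coordinate e the kernel is a multiple of the identity plus a multiple of
    the all-ones matrix.\<close>
  have split: "(\<Sum>w\<in>B. c (if v = w then d else Suc d) *\<^sub>R g (y(e := w))) =
      (c d - c (Suc d)) *\<^sub>R g (y(e := v)) + c (Suc d) *\<^sub>R (\<Sum>w\<in>B. g (y(e := w)))" if "v \<in> B" for y v d
  proof -
    have "(\<Sum>w\<in>B. c (if v = w then d else Suc d) *\<^sub>R g (y(e := w))) =
      (\<Sum>w\<in>B. (if v = w then (c d - c (Suc d)) *\<^sub>R g (y(e := w)) else 0) + c (Suc d) *\<^sub>R g (y(e := w)))"
      by (rule sum.cong) (auto simp: algebra_simps)
    then show ?thesis
      using that insert.prems(1) by (simp add: sum.distrib scaleR_sum_right)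
  qed
  define S where "S y = (\<Sum>w\<in>B. g (y(e := w)))" for y
  have eq': "(\<Sum>y \<in> I \<rightarrow>\<^sub>E B. (c (coord_dist I z y) - c (Suc (coord_dist I z y))) *\<^sub>R g (y(e := v))
      + c (Suc (coord_dist I z y)) *\<^sub>R S y) = 0" if "z \<in> I \<rightarrow>\<^sub>E B" "v \<in> B" for z v
    using eq[OF that] by (simp add: split[OF that(2)] S_def)
  \<comment> \<open>Adding the equations \<open>eq'\<close> over all v gives an operator on S with
    the coefficients of \<open>hamming_eigenvalue_Suc\<close>.\<close>
  have S0: "S z = 0" if z: "z \<in> I \<rightarrow>\<^sub>E B" for z
  proof (rule insert.IH[where c = "\<lambda>i. c i + (real ?p - 1) * c (Suc i)", OF _ _ _ z])
    fix z assume z: "z \<in> I \<rightarrow>\<^sub>E B"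
    have "0 = (\<Sum>v\<in>B. \<Sum>y \<in> I \<rightarrow>\<^sub>E B. (c (coord_dist I z y) - c (Suc (coord_dist I z y))) *\<^sub>R g (y(e := v))
      + c (Suc (coord_dist I z y)) *\<^sub>R S y)"
      using eq'[OF z] by simp
    also have "\<dots> = (\<Sum>y \<in> I \<rightarrow>\<^sub>E B. (c (coord_dist I z y) - c (Suc (coord_dist I z y))) *\<^sub>R S y
      + (real ?p * c (Suc (coord_dist I z y))) *\<^sub>R S y)"
      by (subst sum.swap) (simp add: sum.distrib S_def scaleR_sum_right sum_constant_scaleR)
    also have "\<dots> = (\<Sum>y \<in> I \<rightarrow>\<^sub>E B. (c (coord_dist I z y) + (real ?p - 1) * c (Suc (coord_dist I z y))) *\<^sub>R S y)"
      by (simp add: algebra_simps)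
    finally show "(\<Sum>y \<in> I \<rightarrow>\<^sub>E B. (c (coord_dist I z y) + (real ?p - 1) * c (Suc (coord_dist I z y))) *\<^sub>R S y) = 0"
      by simp
  next
    fix l assume "l \<le> card I"
    then show "hamming_eigenvalue ?p (\<lambda>i. c i + (real ?p - 1) * c (Suc i)) l (card I) \<noteq> 0"
      using ev[of l] by (simp add: hamming_eigenvalue_Suc)
  qed (fact insert.prems)
  \<comment> \<open>Subtracting two of the equations removes S and leaves the coefficients of
    \<open>hamming_eigenvalue_Suc_Suc\<close>.\<close>
  have D0: "g (z(e := v)) - g (z(e := w)) = 0" if z: "z \<in> I \<rightarrow>\<^sub>E B" and vw: "v \<in> B" "w \<in> B" for z v w
  proof (rule insert.IH[where c = "\<lambda>i. c i - c (Suc i)" and g = "\<lambda>z. g (z(e := v)) - g (z(e := w))", OF _ _ _ z])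
    fix z assume "z \<in> I \<rightarrow>\<^sub>E B"
    then show "(\<Sum>y \<in> I \<rightarrow>\<^sub>E B. (c (coord_dist I z y) - c (Suc (coord_dist I z y))) *\<^sub>R (g (y(e := v)) - g (y(e := w)))) = 0"
      using eq'[of z v] eq'[of z w] vw by (simp add: scaleR_diff_right sum_subtractf S0)
  next
    fix l assume "l \<le> card I"
    then show "hamming_eigenvalue ?p (\<lambda>i. c i - c (Suc i)) l (card I) \<noteq> 0"
      using ev[of "Suc l"] by (simp add: hamming_eigenvalue_Suc_Suc)
  qed (fact insert.prems)
  \<comment> \<open>Along the line through x in direction e, g is constant and has sum zero; the
    line is nonempty, so g x = 0.\<close>
  let ?z = "x(e := undefined)"
  have z: "?z \<in> I \<rightarrow>\<^sub>E B" "x e \<in> B" "?z(e := x e) = x"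
    using insert.prems(4) insert.hyps by (auto simp: PiE_def extensional_def Pi_def)
  have "real ?p *\<^sub>R g x = (\<Sum>v\<in>B. g (?z(e := x e)))"
    by (simp add: sum_constant_scaleR)
  also have "\<dots> = S ?z"
    unfolding S_def using D0[OF z(1,2)] by (intro sum.cong) auto
  finally have "real ?p *\<^sub>R g x = 0"
    using S0[OF z(1)] by simp
  moreover have "?p \<noteq> 0"
    using z(2) insert.prems(1) by auto
  ultimately show ?case by simp
qed

section \<open>Adjacency restricted to a set of coordinates\<close>

definition neighbour_sum :: "'b set \<Rightarrow> 'a set \<Rightarrow> (('a \<Rightarrow> 'b) \<Rightarrow> 'c::comm_monoid_add) \<Rightarrow> ('a \<Rightarrow> 'b) \<Rightarrow> 'c" where
  "neighbour_sum B C g x = (\<Sum>c\<in>C. \<Sum>v\<in>B - {x c}. g (x(c := v)))"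

lemma sum_hamming_sphere_1:
  assumes "\<alpha> \<in> hamming_vertices q n"
  shows "(\<Sum>\<beta> \<in> hamming_sphere q n \<alpha> 1. f \<beta>) = neighbour_sum {..<q} {..<n} f \<alpha>"
proof -
  let ?M = "SIGMA c:{..<n}. {..<q} - {\<alpha> c}"
  have inj: "inj_on (\<lambda>(c, v). \<alpha>(c := v)) ?M"
  proof (rule inj_onI)
    fix a b assume "a \<in> ?M" "b \<in> ?M" "(\<lambda>(c, v). \<alpha>(c := v)) a = (\<lambda>(c, v). \<alpha>(c := v)) b"
    moreover obtain c v c' v' where "a = (c, v)" "b = (c', v')"
      by fastforce
    ultimately have "\<alpha>(c := v) = \<alpha>(c' := v')" "v \<noteq> \<alpha> c" "v' \<noteq> \<alpha> c'"
      by auto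
    then have "c = c' \<and> v = v'"
      by (metis fun_upd_apply)
    then show "a = b"
      using \<open>a = (c, v)\<close> \<open>b = (c', v')\<close> by simp
  qed
  have "hamming_sphere q n \<alpha> 1 = (\<lambda>(c, v). \<alpha>(c := v)) ` ?M"
  proof (intro equalityI subsetI)
    fix \<beta> assume "\<beta> \<in> hamming_sphere q n \<alpha> 1"
    then have \<beta>: "\<beta> \<in> {..<n} \<rightarrow>\<^sub>E {..<q}" and "card {i. i < n \<and> \<alpha> i \<noteq> \<beta> i} = 1"
      by (auto simp: hamming_sphere_def hamming_vertices_def hamming_dist_def)
    then obtain c where c: "{i. i < n \<and> \<alpha> i \<noteq> \<beta> i} = {c}"
      by (auto simp: card_1_singleton_iff)
    then have "c < n" "\<alpha> c \<noteq> \<beta> c" and eq: "\<alpha> i = \<beta> i" if "i \<noteq> c" "i < n" for i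
      using that by blast+
    moreover have "\<beta> = \<alpha>(c := \<beta> c)"
    proof
      fix i
      show "\<beta> i = (\<alpha>(c := \<beta> c)) i"
        using eq[of i] \<beta> assms by (cases "i < n") (auto simp: hamming_vertices_def PiE_def extensional_def)
    qed
    moreover have "\<beta> c < q"
      using c \<beta> by auto
    moreover have "c < n" "\<alpha> c \<noteq> \<beta> c"
      using c by auto
    ultimately have "(c, \<beta> c) \<in> ?M" "\<beta> = (case (c, \<beta> c) of (c, v) \<Rightarrow> \<alpha>(c := v))"
      by auto
    then show "\<beta> \<in> (\<lambda>(c, v). \<alpha>(c := v)) ` ?M"
      by (rule rev_image_eqI)
  next
    fix \<beta> assume "\<beta> \<in> (\<lambda>(c, v). \<alpha>(c := v)) ` ?M"
    then obtain c v where cv: "c < n" "v < q" "v \<noteq> \<alpha> c" "\<beta> = \<alpha>(c := v)"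
      by auto
    then have "{i. i < n \<and> \<alpha> i \<noteq> \<beta> i} = {c}"
      by auto
    then show "\<beta> \<in> hamming_sphere q n \<alpha> 1"
      using cv assms
      by (auto simp: hamming_sphere_def hamming_dist_def hamming_vertices_def PiE_def extensional_def)
  qed
  then have "(\<Sum>\<beta> \<in> hamming_sphere q n \<alpha> 1. f \<beta>) = sum (f \<circ> (\<lambda>(c, v). \<alpha>(c := v))) ?M"
    by (simp only: sum.reindex[OF inj])
  then show ?thesis
    by (simp add: neighbour_sum_def sum.Sigma case_prod_unfold)
qed

text \<open>Adjacency is symmetric: exchanging the old and the new value at c is an involution on
  the pairs of a vertex and a changed value.\<close>

lemma neighbour_sum_adjoint:
  fixes g :: "('a \<Rightarrow> 'b) \<Rightarrow> 'c::real_vector"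
  assumes "finite V" "finite B" "C \<subseteq> V"
  shows "(\<Sum>x \<in> V \<rightarrow>\<^sub>E B. w x *\<^sub>R neighbour_sum B C g x) = (\<Sum>x \<in> V \<rightarrow>\<^sub>E B. neighbour_sum B C w x *\<^sub>R g x)"
proof -
  have fin: "finite (V \<rightarrow>\<^sub>E B)" "finite C"
    using assms by (auto intro: finite_PiE finite_subset)
  have swap: "(\<Sum>x \<in> V \<rightarrow>\<^sub>E B. \<Sum>v \<in> B - {x c}. w x *\<^sub>R g (x(c := v))) =
      (\<Sum>x \<in> V \<rightarrow>\<^sub>E B. \<Sum>v \<in> B - {x c}. w (x(c := v)) *\<^sub>R g x)" if "c \<in> C" for c
  proof -
    let ?T = "SIGMA x:V \<rightarrow>\<^sub>E B. B - {x c}" and ?flip = "\<lambda>(x, v). (x(c := v), x c)"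
    have "(\<Sum>(x, v)\<in>?T. w x *\<^sub>R g (x(c := v))) = (\<Sum>(x, v)\<in>?T. w (x(c := v)) *\<^sub>R g x)"
      by (rule sum.reindex_bij_witness[of _ ?flip ?flip])
        (use that assms in \<open>auto simp: PiE_def extensional_def Pi_def\<close>)
    then show ?thesis
      using fin assms by (simp add: sum.Sigma)
  qed
  have "(\<Sum>x \<in> V \<rightarrow>\<^sub>E B. w x *\<^sub>R neighbour_sum B C g x) =
      (\<Sum>c\<in>C. \<Sum>x \<in> V \<rightarrow>\<^sub>E B. \<Sum>v \<in> B - {x c}. w x *\<^sub>R g (x(c := v)))"
    unfolding neighbour_sum_def scaleR_sum_right by (rule sum.swap)
  also have "\<dots> = (\<Sum>c\<in>C. \<Sum>x \<in> V \<rightarrow>\<^sub>E B. \<Sum>v \<in> B - {x c}. w (x(c := v)) *\<^sub>R g x)"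
    by (rule sum.cong) (simp_all add: swap)
  also have "\<dots> = (\<Sum>x \<in> V \<rightarrow>\<^sub>E B. neighbour_sum B C w x *\<^sub>R g x)"
    unfolding neighbour_sum_def scaleR_sum_left by (rule sum.swap)
  finally show ?thesis .
qed

text \<open>The action of the adjacency matrix of the Hamming graph with \<open>k\<close> coordinates and alphabet of size
  \<open>p\<close> on kernels that depend on the distance only.\<close>

definition adj_op :: "nat \<Rightarrow> nat \<Rightarrow> (nat \<Rightarrow> real) \<Rightarrow> nat \<Rightarrow> real" where
  "adj_op p k \<phi> d = real d * \<phi> (d - 1) + real d * (real p - 2) * \<phi> d
     + (real k - real d) * (real p - 1) * \<phi> (Suc d)"

lemma coord_dist_remove:
  assumes "finite I" "c \<in> I"
  shows "coord_dist I x y = (if x c = y c then 0 else 1) + coord_dist (I - {c}) x y"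
  using coord_dist_insert[of "I - {c}" c x y] assms by (simp add: insert_absorb)

text \<open>Where x and y differ, one change lowers the distance and p - 2 changes keep it, with p =
  \<open>card B\<close>; where they agree, p - 1 changes raise it.\<close>

lemma neighbour_sum_coord_dist:
  fixes \<phi> :: "nat \<Rightarrow> real"
  assumes "finite I" "finite B" "\<And>i. i \<in> I \<Longrightarrow> x i \<in> B" "\<And>i. i \<in> I \<Longrightarrow> y i \<in> B"
  shows "neighbour_sum B I (\<lambda>y. \<phi> (coord_dist I x y)) y = adj_op (card B) (card I) \<phi> (coord_dist I x y)"
proof -
  let ?d = "coord_dist I x y" and ?p = "real (card B)"
  have inner: "(\<Sum>v\<in>B - {y c}. \<phi> (coord_dist I x (y(c := v)))) =
      (if x c \<noteq> y c then \<phi> (?d - 1) + (?p - 2) * \<phi> ?d else (?p - 1) * \<phi> (Suc ?d))" if c: "c \<in> I" for c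
  proof -
    let ?e = "coord_dist (I - {c}) x y"
    have upd: "coord_dist I x (y(c := v)) = (if x c = v then 0 else 1) + ?e" for v
      using coord_dist_remove[OF assms(1) c, of x "y(c := v)"] coord_dist_cong[of "I - {c}" x x "y(c := v)" y]
      by simp
    show ?thesis
    proof (cases "x c = y c")
      case True
      have "(\<Sum>v\<in>B - {y c}. \<phi> (coord_dist I x (y(c := v)))) = (\<Sum>v\<in>B - {y c}. \<phi> (Suc ?d))"
        using True coord_dist_remove[OF assms(1) c, of x y] by (intro sum.cong) (auto simp: upd)
      moreover have "card B \<ge> 1"
        using assms(2,4) c by (metis One_nat_def Suc_leI card_gt_0_iff empty_iff)
      ultimately show ?thesis
        using True assms(2,4) c by (simp add: of_nat_diff)
    next
      case False
      have mem: "x c \<in> B - {y c}"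
        using False assms(3) c by simp
      have "card {x c, y c} \<le> card B"
        using assms(2-4) c by (intro card_mono) auto
      then have "card B \<ge> 2"
        using False by simp
      then have "real (card (B - {y c} - {x c})) = ?p - 2"
        using mem assms(2,4) c by (simp add: of_nat_diff)
      moreover have "(\<Sum>v\<in>B - {y c}. \<phi> (coord_dist I x (y(c := v)))) =
          \<phi> ?e + (\<Sum>v\<in>B - {y c} - {x c}. \<phi> (coord_dist I x (y(c := v))))"
        using assms(2) by (subst sum.remove[OF _ mem]) (auto simp: upd)
      moreover have "(\<Sum>v\<in>B - {y c} - {x c}. \<phi> (coord_dist I x (y(c := v)))) =
          (\<Sum>v\<in>B - {y c} - {x c}. \<phi> ?d)"
        using False coord_dist_remove[OF assms(1) c, of x y] by (intro sum.cong) (auto simp: upd)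
      ultimately show ?thesis
        using False coord_dist_remove[OF assms(1) c, of x y] by simp
    qed
  qed
  have "neighbour_sum B I (\<lambda>y. \<phi> (coord_dist I x y)) y =
      (\<Sum>c\<in>I. if x c \<noteq> y c then \<phi> (?d - 1) + (?p - 2) * \<phi> ?d else (?p - 1) * \<phi> (Suc ?d))"
    unfolding neighbour_sum_def by (rule sum.cong) (simp_all add: inner)
  also have "\<dots> = real ?d * (\<phi> (?d - 1) + (?p - 2) * \<phi> ?d)
      + real (card {c \<in> I. \<not> x c \<noteq> y c}) * ((?p - 1) * \<phi> (Suc ?d))"
    using assms(1) by (simp add: sum.If_cases coord_dist_def Int_def)
  also have "real (card {c \<in> I. \<not> x c \<noteq> y c}) = real (card I) - real ?d"
  proof -
    have "card I = ?d + card {c \<in> I. \<not> x c \<noteq> y c}"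
      unfolding coord_dist_def
      by (subst card_Un_disjoint[symmetric]) (use assms(1) in \<open>auto intro: arg_cong[of _ _ card]\<close>)
    then show ?thesis by simp
  qed
  finally show ?thesis
    by (simp add: adj_op_def algebra_simps)
qed

definition delta :: "nat \<Rightarrow> nat \<Rightarrow> real" where
  "delta j d = (if d = j then 1 else 0)"

text \<open>A column of the tridiagonal matrix of \<open>adj_op\<close>. The case j = 0 suppresses
  the term that the truncated difference j - 1 would produce.\<close>

lemma adj_op_delta:
  "adj_op p k (delta j) = (\<lambda>d. real (Suc j) * delta (Suc j) d + real j * (real p - 2) * delta j d
     + (if j = 0 then 0 else (real k - real (j - 1)) * (real p - 1)) * delta (j - 1) d)"
proof
  fix d
  show "adj_op p k (delta j) d = real (Suc j) * delta (Suc j) d + real j * (real p - 2) * delta j d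
     + (if j = 0 then 0 else (real k - real (j - 1)) * (real p - 1)) * delta (j - 1) d"
    by (cases d; cases j) (auto simp: adj_op_def delta_def)
qed

section \<open>Sums of eigenfunctions over faces\<close>

locale hamming_eigenfunction =
  fixes q n :: nat and ev :: real and f :: "(nat \<Rightarrow> nat) \<Rightarrow> complex" and I :: "nat set"
  assumes eigen: "lambda_function q n (of_real ev) f"
    and I_subset: "I \<subseteq> {..<n}"
begin

abbreviation "J \<equiv> {..<n} - I"

text \<open>With \<open>delta 0\<close> as first kernel, only vertices agreeing with \<alpha> on I
  count; with \<open>delta 0\<close> as second kernel, only those in the face through \<alpha> with
  free coordinates I.\<close>

definition ksum :: "(nat \<Rightarrow> real) \<Rightarrow> (nat \<Rightarrow> real) \<Rightarrow> (nat \<Rightarrow> nat) \<Rightarrow> complex" where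
  "ksum \<phi> \<psi> \<alpha> = (\<Sum>\<beta> \<in> hamming_vertices q n. (\<phi> (coord_dist I \<alpha> \<beta>) * \<psi> (coord_dist J \<alpha> \<beta>)) *\<^sub>R f \<beta>)"

lemma finite_I [simp]: "finite I"
  using I_subset finite_subset by blast

lemma card_J: "real (card J) = real n - real (card I)"
  using I_subset card_mono[OF _ I_subset] by (simp add: card_Diff_subset of_nat_diff)

lemma vertex_less: "\<alpha> \<in> hamming_vertices q n \<Longrightarrow> i < n \<Longrightarrow> \<alpha> i \<in> {..<q}"
  by (auto simp: hamming_vertices_def)

text \<open>By self-adjointness the eigenvalue equation passes from f to the kernel, where adjacency
  obeys a Leibniz rule.\<close>

lemma ksum_eigen:
  assumes \<alpha>: "\<alpha> \<in> hamming_vertices q n"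
  shows "ev *\<^sub>R ksum \<phi> \<psi> \<alpha> = ksum (adj_op q (card I) \<phi>) \<psi> \<alpha> + ksum \<phi> (adj_op q (card J) \<psi>) \<alpha>"
proof -
  define w where "w \<beta> = \<phi> (coord_dist I \<alpha> \<beta>) * \<psi> (coord_dist J \<alpha> \<beta>)" for \<beta>
  let ?V = "hamming_vertices q n"
  have w: "neighbour_sum {..<q} {..<n} w \<beta> =
      adj_op q (card I) \<phi> (coord_dist I \<alpha> \<beta>) * \<psi> (coord_dist J \<alpha> \<beta>)
      + \<phi> (coord_dist I \<alpha> \<beta>) * adj_op q (card J) \<psi> (coord_dist J \<alpha> \<beta>)" if \<beta>: "\<beta> \<in> ?V" for \<beta>
  proof -
    have inI: "coord_dist J \<alpha> (\<beta>(c := v)) = coord_dist J \<alpha> \<beta>" if "c \<in> I" for c v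
      by (rule coord_dist_cong) (use that in auto)
    have inJ: "coord_dist I \<alpha> (\<beta>(c := v)) = coord_dist I \<alpha> \<beta>" if "c \<in> J" for c v
      by (rule coord_dist_cong) (use that in auto)
    \<comment> \<open>A change inside I leaves the distance on J alone, and conversely, so each part
      acts on one factor only.\<close>
    have "neighbour_sum {..<q} {..<n} w \<beta> = neighbour_sum {..<q} I w \<beta> + neighbour_sum {..<q} J w \<beta>"
      unfolding neighbour_sum_def
      using sum.subset_diff[OF I_subset, of "\<lambda>c. \<Sum>v\<in>{..<q} - {\<beta> c}. w (\<beta>(c := v))"] by simp
    also have "neighbour_sum {..<q} I w \<beta> =
        neighbour_sum {..<q} I (\<lambda>\<beta>. \<phi> (coord_dist I \<alpha> \<beta>)) \<beta> * \<psi> (coord_dist J \<alpha> \<beta>)"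
      unfolding neighbour_sum_def w_def sum_distrib_right by (intro sum.cong refl) (simp add: inI)
    also have "neighbour_sum {..<q} I (\<lambda>\<beta>. \<phi> (coord_dist I \<alpha> \<beta>)) \<beta> = adj_op q (card I) \<phi> (coord_dist I \<alpha> \<beta>)"
      using I_subset vertex_less[OF \<alpha>] vertex_less[OF \<beta>] by (subst neighbour_sum_coord_dist) auto
    also have "neighbour_sum {..<q} J w \<beta> =
        \<phi> (coord_dist I \<alpha> \<beta>) * neighbour_sum {..<q} J (\<lambda>\<beta>. \<psi> (coord_dist J \<alpha> \<beta>)) \<beta>"
      unfolding neighbour_sum_def w_def sum_distrib_left by (intro sum.cong refl) (simp only: inJ)
    also have "neighbour_sum {..<q} J (\<lambda>\<beta>. \<psi> (coord_dist J \<alpha> \<beta>)) \<beta> = adj_op q (card J) \<psi> (coord_dist J \<alpha> \<beta>)"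
      using vertex_less[OF \<alpha>] vertex_less[OF \<beta>] by (subst neighbour_sum_coord_dist) auto
    finally show ?thesis .
  qed
  have "ev *\<^sub>R ksum \<phi> \<psi> \<alpha> = (\<Sum>\<beta>\<in>?V. w \<beta> *\<^sub>R neighbour_sum {..<q} {..<n} f \<beta>)"
    unfolding ksum_def scaleR_sum_right
  proof (rule sum.cong[OF refl])
    fix \<beta> assume "\<beta> \<in> ?V"
    then have "neighbour_sum {..<q} {..<n} f \<beta> = ev *\<^sub>R f \<beta>"
      using eigen sum_hamming_sphere_1[of \<beta> q n f] by (simp add: lambda_function_def scaleR_conv_of_real)
    then show "ev *\<^sub>R (\<phi> (coord_dist I \<alpha> \<beta>) * \<psi> (coord_dist J \<alpha> \<beta>)) *\<^sub>R f \<beta> =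
        w \<beta> *\<^sub>R neighbour_sum {..<q} {..<n} f \<beta>"
      by (simp add: w_def mult_ac)
  qed
  also have "\<dots> = (\<Sum>\<beta>\<in>?V. neighbour_sum {..<q} {..<n} w \<beta> *\<^sub>R f \<beta>)"
    unfolding hamming_vertices_def by (rule neighbour_sum_adjoint) auto
  also have "\<dots> = ksum (adj_op q (card I) \<phi>) \<psi> \<alpha> + ksum \<phi> (adj_op q (card J) \<psi>) \<alpha>"
    unfolding ksum_def sum.distrib[symmetric] by (rule sum.cong) (simp_all add: w scaleR_left_distrib)
  finally show ?thesis .
qed

text \<open>The distance is symmetric, so moving the base point \<alpha> inside I acts on the kernel
  in the same way as moving \<beta>.\<close>

lemma neighbour_sum_ksum:
  assumes \<alpha>: "\<alpha> \<in> hamming_vertices q n"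
  shows "neighbour_sum {..<q} I (ksum \<phi> \<psi>) \<alpha> = ksum (adj_op q (card I) \<phi>) \<psi> \<alpha>"
proof -
  have "neighbour_sum {..<q} I (ksum \<phi> \<psi>) \<alpha> = (\<Sum>\<beta> \<in> hamming_vertices q n. \<Sum>c\<in>I. \<Sum>v\<in>{..<q} - {\<alpha> c}.
      (\<phi> (coord_dist I (\<alpha>(c := v)) \<beta>) * \<psi> (coord_dist J (\<alpha>(c := v)) \<beta>)) *\<^sub>R f \<beta>)"
    unfolding neighbour_sum_def ksum_def by (subst sum.swap, subst sum.swap) (rule refl)
  also have "\<dots> = ksum (adj_op q (card I) \<phi>) \<psi> \<alpha>"
    unfolding ksum_def
  proof (rule sum.cong[OF refl])
    fix \<beta> assume \<beta>: "\<beta> \<in> hamming_vertices q n"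
    have inI: "coord_dist J (\<alpha>(c := v)) \<beta> = coord_dist J \<alpha> \<beta>" if "c \<in> I" for c v
      by (rule coord_dist_cong) (use that in auto)
    have "(\<Sum>c\<in>I. \<Sum>v\<in>{..<q} - {\<alpha> c}.
        (\<phi> (coord_dist I (\<alpha>(c := v)) \<beta>) * \<psi> (coord_dist J (\<alpha>(c := v)) \<beta>)) *\<^sub>R f \<beta>) =
      (neighbour_sum {..<q} I (\<lambda>\<alpha>. \<phi> (coord_dist I \<beta> \<alpha>)) \<alpha> * \<psi> (coord_dist J \<alpha> \<beta>)) *\<^sub>R f \<beta>"
      unfolding neighbour_sum_def sum_distrib_right scaleR_sum_left
      by (intro sum.cong refl) (simp add: inI coord_dist_commute[of I])
    also have "neighbour_sum {..<q} I (\<lambda>\<alpha>. \<phi> (coord_dist I \<beta> \<alpha>)) \<alpha> = adj_op q (card I) \<phi> (coord_dist I \<alpha> \<beta>)"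
      using I_subset vertex_less[OF \<alpha>] vertex_less[OF \<beta>]
      by (subst neighbour_sum_coord_dist) (auto simp: coord_dist_commute)
    finally show "(\<Sum>c\<in>I. \<Sum>v\<in>{..<q} - {\<alpha> c}.
        (\<phi> (coord_dist I (\<alpha>(c := v)) \<beta>) * \<psi> (coord_dist J (\<alpha>(c := v)) \<beta>)) *\<^sub>R f \<beta>) =
      (adj_op q (card I) \<phi> (coord_dist I \<alpha> \<beta>) * \<psi> (coord_dist J \<alpha> \<beta>)) *\<^sub>R f \<beta>" .
  qed
  finally show ?thesis .
qed

text \<open>Three terms match the tridiagonal \<open>adj_op\<close>; shorter combinations are padded
  with coefficient 0.\<close>

lemma ksum_linear1:
  "ksum (\<lambda>d. a * \<phi>1 d + b * \<phi>2 d + c * \<phi>3 d) \<psi> \<alpha> = a *\<^sub>R ksum \<phi>1 \<psi> \<alpha> + b *\<^sub>R ksum \<phi>2 \<psi> \<alpha> + c *\<^sub>R ksum \<phi>3 \<psi> \<alpha>"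
  by (simp add: ksum_def scaleR_sum_right algebra_simps sum.distrib)

lemma ksum_linear2:
  "ksum \<phi> (\<lambda>d. a * \<psi>1 d + b * \<psi>2 d + c * \<psi>3 d) \<alpha> = a *\<^sub>R ksum \<phi> \<psi>1 \<alpha> + b *\<^sub>R ksum \<phi> \<psi>2 \<alpha> + c *\<^sub>R ksum \<phi> \<psi>3 \<alpha>"
  by (simp add: ksum_def scaleR_sum_right algebra_simps sum.distrib)

lemma ksum_recurrence:
  assumes "\<alpha> \<in> hamming_vertices q n"
  shows "real (Suc j) *\<^sub>R ksum \<phi> (delta (Suc j)) \<alpha> = (ev - real j * (real q - 2)) *\<^sub>R ksum \<phi> (delta j) \<alpha>
    - ksum (adj_op q (card I) \<phi>) (delta j) \<alpha>
    - (if j = 0 then 0 else (real n - real (card I) - real (j - 1)) * (real q - 1)) *\<^sub>R ksum \<phi> (delta (j - 1)) \<alpha>"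
  using ksum_eigen[OF assms, of \<phi> "delta j"] unfolding adj_op_delta ksum_linear2 card_J
  by (simp add: algebra_simps)

text \<open>Both sides agree at j = 0 and satisfy the same recurrence: the middle bracket in
  \<open>r_gf_recurrence\<close> is \<open>adj_op\<close> applied to the coefficients.\<close>

lemma ksum_delta_delta:
  assumes "\<alpha> \<in> hamming_vertices q n" and ev: "ev = (real q - 1) * real n - real q * real h"
  shows "ksum (delta 0) (delta j) \<alpha> = ksum (\<lambda>i. fps_nth (r_gf q n h (card I) i) j) (delta 0) \<alpha>"
  using assms(1)
proof (induction j arbitrary: \<alpha> rule: less_induct)
  case (less j)
  let ?r = "\<lambda>j i. fps_nth (r_gf q n h (card I) i) j"
  show ?case
  proof (cases j)
    case 0
    have "?r 0 = delta 0"
      by (auto simp: r_gf_def delta_def fps_mult_nth_0 fun_eq_iff)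
    then show ?thesis by (simp add: 0)
  next
    case (Suc m)
    let ?a = "ev - real m * (real q - 2)"
      and ?b = "if m = 0 then 0 else (real n - real (card I) - real (m - 1)) * (real q - 1)"
    have nb: "\<alpha>(c := v) \<in> hamming_vertices q n" if "c \<in> I" "v \<in> {..<q}" for c v
      using less.prems that I_subset by (auto simp: hamming_vertices_def PiE_def extensional_def)
    \<comment> \<open>Written as a sum over neighbours of \<alpha> inside I, this term is open to
      the induction hypothesis, which therefore has to hold for every base point.\<close>
    have "ksum (adj_op q (card I) (delta 0)) (delta m) \<alpha> = neighbour_sum {..<q} I (ksum (delta 0) (delta m)) \<alpha>"
      using neighbour_sum_ksum[OF less.prems] by simp
    also have "\<dots> = neighbour_sum {..<q} I (ksum (?r m) (delta 0)) \<alpha>"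
      unfolding neighbour_sum_def by (intro sum.cong refl less.IH nb) (use Suc in auto)
    also have "\<dots> = ksum (adj_op q (card I) (?r m)) (delta 0) \<alpha>"
      by (rule neighbour_sum_ksum[OF less.prems])
    finally have A: "ksum (adj_op q (card I) (delta 0)) (delta m) \<alpha> = ksum (adj_op q (card I) (?r m)) (delta 0) \<alpha>" .
    have "real (Suc m) *\<^sub>R ksum (delta 0) (delta (Suc m)) \<alpha> = ?a *\<^sub>R ksum (?r m) (delta 0) \<alpha>
        + (- 1) *\<^sub>R ksum (adj_op q (card I) (?r m)) (delta 0) \<alpha> + (- ?b) *\<^sub>R ksum (?r (m - 1)) (delta 0) \<alpha>"
      unfolding ksum_recurrence[OF less.prems] A using less.IH[of m] less.IH[of "m - 1"] less.prems Suc
      by simp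
    also have "\<dots> = ksum (\<lambda>i. ?a * ?r m i + (- 1) * adj_op q (card I) (?r m) i + (- ?b) * ?r (m - 1) i) (delta 0) \<alpha>"
      by (simp only: ksum_linear1)
    also have "(\<lambda>i. ?a * ?r m i + (- 1) * adj_op q (card I) (?r m) i + (- ?b) * ?r (m - 1) i) =
        (\<lambda>i. real (Suc m) * ?r (Suc m) i + 0 * ?r m i + 0 * ?r m i)"
      unfolding r_gf_recurrence by (auto simp: fun_eq_iff adj_op_def ev algebra_simps)
    also have "ksum \<dots> (delta 0) \<alpha> = real (Suc m) *\<^sub>R ksum (?r (Suc m)) (delta 0) \<alpha>"
      unfolding ksum_linear1 by simp
    finally show ?thesis
      unfolding Suc by (simp del: of_nat_Suc)
  qed
qed

text \<open>When \<open>f\<close> vanishes on smaller weights, only the vertices of full support on the face of \<open>I\<close> contribute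
  to \<open>ksum \<phi> (delta 0)\<close>, and these form a Hamming graph with alphabet \<open>{1..<q}\<close>.\<close>

lemma vanish_on_support:
  assumes zero: "\<And>\<beta>. \<beta> \<in> hamming_vertices q n \<Longrightarrow> card {i. i < n \<and> \<beta> i \<noteq> 0} < card I \<Longrightarrow> f \<beta> = 0"
    and ksum0: "\<And>\<beta>. \<beta> \<in> hamming_vertices q n \<Longrightarrow> {i. i < n \<and> \<beta> i \<noteq> 0} = I \<Longrightarrow> ksum \<phi> (delta 0) \<beta> = 0"
    and ev: "\<And>l. l \<le> card I \<Longrightarrow> hamming_eigenvalue (q - 1) \<phi> l (card I) \<noteq> 0"
    and \<alpha>: "\<alpha> \<in> hamming_vertices q n" "{i. i < n \<and> \<alpha> i \<noteq> 0} = I"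
  shows "f \<alpha> = 0"
proof -
  \<comment> \<open>Extension by zero is inverse to restriction to I and identifies words over
    {1..<q} with the vertices of support I.\<close>
  define ext :: "(nat \<Rightarrow> nat) \<Rightarrow> nat \<Rightarrow> nat" where "ext y = (\<lambda>i\<in>{..<n}. if i \<in> I then y i else 0)" for y
  let ?F = "{\<beta> \<in> hamming_vertices q n. {i. i < n \<and> \<beta> i \<noteq> 0} = I}"
  have ext_in: "ext y \<in> ?F" if "y \<in> I \<rightarrow>\<^sub>E {1..<q}" for y
    using that I_subset \<alpha>(1) by (fastforce simp: ext_def hamming_vertices_def PiE_def Pi_def)
  have restrict_in: "restrict \<beta> I \<in> I \<rightarrow>\<^sub>E {1..<q}" if "\<beta> \<in> ?F" for \<beta>
    using that by (fastforce simp: hamming_vertices_def PiE_def Pi_def)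
  have ext_restrict: "ext (restrict \<beta> I) = \<beta>" if "\<beta> \<in> ?F" for \<beta>
    using that by (fastforce simp: ext_def hamming_vertices_def PiE_def extensional_def)
  have restrict_ext: "restrict (ext y) I = y" if "y \<in> I \<rightarrow>\<^sub>E {1..<q}" for y
    using that I_subset by (fastforce simp: ext_def PiE_def extensional_def)
  have "(\<Sum>y \<in> I \<rightarrow>\<^sub>E {1..<q}. \<phi> (coord_dist I x y) *\<^sub>R f (ext y)) = 0" if x: "x \<in> I \<rightarrow>\<^sub>E {1..<q}" for x
  proof -
    have "(\<Sum>y \<in> I \<rightarrow>\<^sub>E {1..<q}. \<phi> (coord_dist I x y) *\<^sub>R f (ext y)) =
        (\<Sum>\<beta>\<in>?F. (\<phi> (coord_dist I (ext x) \<beta>) * delta 0 (coord_dist J (ext x) \<beta>)) *\<^sub>R f \<beta>)"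
    proof (rule sum.reindex_bij_witness[of _ "\<lambda>\<beta>. restrict \<beta> I" ext])
      fix y assume y: "y \<in> I \<rightarrow>\<^sub>E {1..<q}"
      have "coord_dist I (ext x) (ext y) = coord_dist I x y"
        by (rule coord_dist_cong) (use I_subset in \<open>auto simp: ext_def\<close>)
      moreover have "coord_dist J (ext x) (ext y) = 0"
        by (auto simp: coord_dist_def ext_def)
      ultimately show "(\<phi> (coord_dist I (ext x) (ext y)) * delta 0 (coord_dist J (ext x) (ext y))) *\<^sub>R f (ext y) =
          \<phi> (coord_dist I x y) *\<^sub>R f (ext y)"
        by (simp add: delta_def)
    qed (use ext_in restrict_in ext_restrict restrict_ext in auto)
    also have "\<dots> = ksum \<phi> (delta 0) (ext x)"
      unfolding ksum_def
    proof (rule sum.mono_neutral_left)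
      show "\<forall>\<beta>\<in>hamming_vertices q n - ?F.
          (\<phi> (coord_dist I (ext x) \<beta>) * delta 0 (coord_dist J (ext x) \<beta>)) *\<^sub>R f \<beta> = 0"
      proof
        fix \<beta> assume \<beta>: "\<beta> \<in> hamming_vertices q n - ?F"
        show "(\<phi> (coord_dist I (ext x) \<beta>) * delta 0 (coord_dist J (ext x) \<beta>)) *\<^sub>R f \<beta> = 0"
        proof (cases "coord_dist J (ext x) \<beta> = 0")
          case True
          then have "{i \<in> J. ext x i \<noteq> \<beta> i} = {}"
            by (simp add: coord_dist_def)
          then have "\<beta> i = 0" if "i < n" "i \<notin> I" for i
            using that by (auto simp: ext_def)
          then have "{i. i < n \<and> \<beta> i \<noteq> 0} \<subset> I"
            using \<beta> by auto
          then have "card {i. i < n \<and> \<beta> i \<noteq> 0} < card I"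
            by (simp add: psubset_card_mono)
          then show ?thesis
            using zero \<beta> by simp
        qed (simp add: delta_def)
      qed
    qed (auto simp: hamming_vertices_def intro: finite_PiE)
    finally show ?thesis
      using ksum0 ext_in[OF x] by simp
  qed
  then have "f (ext (restrict \<alpha> I)) = 0"
    using ev restrict_in[of \<alpha>] \<alpha>
    by (intro hamming_operator_injective[of I "{1..<q}" \<phi> "\<lambda>y. f (ext y)"]) auto
  then show ?thesis
    using ext_restrict[of \<alpha>] \<alpha> by simp
qed

text \<open>The kernel \<open>\<phi>\<close> projects onto the functions with zero sum in every direction of \<open>I\<close>; on those the
  directions outside \<open>I\<close> would have to account for an eigenvalue exceeding their degree.\<close>

lemma ksum_geometric_eq_0:
  fixes h :: nat
  defines "\<phi> \<equiv> \<lambda>d. (- 1 / (real q - 1)) ^ d"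
  assumes \<alpha>: "\<alpha> \<in> hamming_vertices q n" and q: "q > 2"
    and ev: "ev = (real q - 1) * real n - real q * real h" and h: "h < card I"
  shows "ksum \<phi> (delta 0) \<alpha> = 0"
proof -
  define F where "F j = ksum \<phi> (delta j) \<alpha>" for j
  define m where "m = card J"
  define e where "e = real (card I) - real h"
  define p where "p = real q - 1"
  have p: "p > 0" and e: "e \<ge> 1"
    using q h by (auto simp: p_def e_def)
  have mn: "real m = real n - real (card I)"
    unfolding m_def by (rule card_J)
  \<comment> \<open>On functions of zero sum in every direction of I, each direction contributes the
    eigenvalue -1.\<close>
  have adj: "adj_op q (card I) \<phi> = (\<lambda>d. (- real (card I)) * \<phi> d + 0 * \<phi> d + 0 * \<phi> d)"
  proof
    fix d
    have S: "\<phi> (Suc d) * p = - \<phi> d" for d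
      using p by (simp add: \<phi>_def p_def)
    have "real d * \<phi> (d - 1) = - real d * p * \<phi> d"
    proof (cases d)
      case (Suc m)
      then have "\<phi> (d - 1) = - (\<phi> d * p)"
        using S[of m] by simp
      then show ?thesis
        by simp
    qed simp
    then have "adj_op q (card I) \<phi> d = - real d * p * \<phi> d + real d * (p - 1) * \<phi> d
        + (real (card I) - real d) * (\<phi> (Suc d) * p)"
      by (simp add: adj_op_def p_def)
    then show "adj_op q (card I) \<phi> d = (- real (card I)) * \<phi> d + 0 * \<phi> d + 0 * \<phi> d"
      unfolding S by (simp add: algebra_simps)
  qed
  \<comment> \<open>At j = 0 this is ev + |I| = p m + (p+1) e, the eigenvalue left for the m
    directions outside I; their degree is only p m.\<close>
  let ?a = "\<lambda>j. p * real m + (p + 1) * e - real j * (p - 1)"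
  have rec: "real (Suc j) *\<^sub>R F (Suc j) = ?a j *\<^sub>R F j
      - (if j = 0 then 0 else (real m - real (j - 1)) * p) *\<^sub>R F (j - 1)" for j
  proof -
    have a: "?a j = (ev - real j * (real q - 2)) + real (card I)"
      by (simp add: ev p_def mn e_def algebra_simps)
    show ?thesis
      using ksum_recurrence[OF \<alpha>, of j \<phi>]
      unfolding a scaleR_left_distrib unfolding adj ksum_linear1 F_def mn[symmetric] p_def by simp
  qed
  \<comment> \<open>If the eigenvalue were the degree (e = 0), the recurrence would give (j+1)
    F(j+1) = p (m-j) F(j). The surplus (p+1) e makes F grow faster and keeps F(m+1) a positive
    multiple of F(0).\<close>
  have "\<exists>u v. u > 0 \<and> F j = u *\<^sub>R F 0 \<and> F (Suc j) = v *\<^sub>R F 0 \<and>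
      real (Suc j) * v \<ge> (p * (real m - real j) + (p + 1) * e) * u" if "j \<le> m" for j
    using that
  proof (induction j)
    case 0
    have "F (Suc 0) = ?a 0 *\<^sub>R F 0"
      using rec[of 0] by simp
    then show ?case
      by (intro exI[of _ 1] exI[of _ "?a 0"]) simp
  next
    case (Suc j)
    then obtain u v where u: "u > 0" and Fj: "F j = u *\<^sub>R F 0" "F (Suc j) = v *\<^sub>R F 0"
      and uv: "real (Suc j) * v \<ge> (p * (real m - real j) + (p + 1) * e) * u"
      by auto
    have nonneg: "p * (real m - real j) * u \<ge> 0" and pos: "(p + 1) * e * u > 0"
      using Suc.prems p e u by auto
    then have le: "real (Suc j) * v \<ge> p * (real m - real j) * u" and "real (Suc j) * v > 0"
      using uv by (auto simp: distrib_right)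
    then have v: "v > 0"
      by (simp add: zero_less_mult_iff)
    define w where "w = (?a (Suc j) * v - (real m - real j) * p * u) / real (Suc (Suc j))"
    have W: "real (Suc (Suc j)) * w = ?a (Suc j) * v - (real m - real j) * p * u"
      by (simp add: w_def del: of_nat_Suc)
    have "real (Suc (Suc j)) *\<^sub>R F (Suc (Suc j)) = real (Suc (Suc j)) *\<^sub>R (w *\<^sub>R F 0)"
      unfolding rec[of "Suc j"] scaleR_scaleR W by (simp add: Fj scaleR_diff_left del: of_nat_Suc)
    then have "F (Suc (Suc j)) = w *\<^sub>R F 0"
      unfolding scaleR_cancel_left by simp
    moreover have "real (Suc (Suc j)) * w = ?a (Suc j) * v - p * (real m - real j) * u"
      unfolding W by (simp only: mult_ac)
    moreover have "?a (Suc j) * v - real (Suc j) * v = (p * (real m - real (Suc j)) + (p + 1) * e) * v"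
      by (simp add: algebra_simps)
    ultimately show ?case
      using v Fj le by (intro exI[of _ v] exI[of _ w]) auto
  qed
  then obtain u v where u: "u > 0" and Fm: "F (Suc m) = v *\<^sub>R F 0" and uv: "real (Suc m) * v \<ge> (p + 1) * e * u"
    by fastforce
  have "(p + 1) * e * u > 0"
    using p e u by auto
  then have "v \<noteq> 0"
    using uv by auto
  \<comment> \<open>Only m coordinates lie outside I, so no vertex is at distance m + 1
    there.\<close>
  moreover have "F (Suc m) = 0"
    unfolding F_def ksum_def
  proof (rule sum.neutral, rule ballI)
    fix \<beta>
    have "coord_dist J \<alpha> \<beta> \<le> m"
      unfolding m_def by (rule coord_dist_le) simp
    then show "(\<phi> (coord_dist I \<alpha> \<beta>) * delta (Suc m) (coord_dist J \<alpha> \<beta>)) *\<^sub>R f \<beta> = 0"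
      by (simp add: delta_def)
  qed
  ultimately have "F 0 = 0"
    using Fm by simp
  then show ?thesis
    by (simp add: F_def)
qed

text \<open>By \<open>ksum_delta_delta\<close> this is a sum of f over vertices that agree with
  \<alpha> on I and have h - |I| further nonzero coordinates; all of them have weight h.\<close>

lemma ksum_r_coeff_eq_0:
  assumes \<alpha>: "\<alpha> \<in> hamming_vertices q n" "{i. i < n \<and> \<alpha> i \<noteq> 0} = I"
    and q: "q > 2" and ev: "ev = (real q - 1) * real n - real q * real h" and h: "card I \<le> h" "h \<le> n"
    and zero: "\<And>\<beta>. \<beta> \<in> hamming_vertices q n \<Longrightarrow> card {i. i < n \<and> \<beta> i \<noteq> 0} = h \<Longrightarrow> f \<beta> = 0"
  shows "ksum (\<lambda>i. r_coeff q n h (card I) i (h - card I)) (delta 0) \<alpha> = 0"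
proof -
  have "ksum (\<lambda>i. r_coeff q n h (card I) i (h - card I)) (delta 0) \<alpha> = ksum (delta 0) (delta (h - card I)) \<alpha>"
    using ksum_delta_delta[OF \<alpha>(1) ev] q h by (simp add: r_coeff_conv_fps)
  also have "\<dots> = 0"
    unfolding ksum_def
  proof (rule sum.neutral, rule ballI)
    fix \<beta> assume \<beta>: "\<beta> \<in> hamming_vertices q n"
    show "(delta 0 (coord_dist I \<alpha> \<beta>) * delta (h - card I) (coord_dist J \<alpha> \<beta>)) *\<^sub>R f \<beta> = 0"
    proof (cases "coord_dist I \<alpha> \<beta> = 0 \<and> coord_dist J \<alpha> \<beta> = h - card I")
      case True
      then have "{i \<in> I. \<alpha> i \<noteq> \<beta> i} = {}"
        by (simp add: coord_dist_def)
      then have "{i. i < n \<and> \<beta> i \<noteq> 0} = I \<union> {i \<in> J. \<alpha> i \<noteq> \<beta> i}"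
        using \<alpha>(2) by auto
      then have "card {i. i < n \<and> \<beta> i \<noteq> 0} = card I + card {i \<in> J. \<alpha> i \<noteq> \<beta> i}"
        by (simp add: card_Un_disjoint Int_def)
      then show ?thesis
        using zero[OF \<beta>] True h by (simp add: coord_dist_def)
    qed (auto simp: delta_def)
  qed
  finally show ?thesis .
qed

end

section \<open>Uniqueness by induction on the weight\<close>

theorem theorem3:
  fixes q n h :: nat and ev :: complex
    and \<phi> f g :: "(nat \<Rightarrow> nat) \<Rightarrow> complex"
  assumes "q > 2" and "n \<ge> 1" and "h \<le> n"
    and "ev = (of_nat q - 1) * of_nat n - of_nat q * of_nat h"
    and "\<forall>k\<in>{0..h}. \<forall>l\<in>{0..k}.
           (\<Sum>i = 0..k. r_coeff q n h k i (h - k) * krawtchouk (q - 1) i (real l) (real k)) \<noteq> 0"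
    and "lambda_function q n ev f" and "lambda_function q n ev g"
    and "\<forall>\<alpha> \<in> hamming_sphere q n (zero_vertex n) h. f \<alpha> = \<phi> \<alpha>"
    and "\<forall>\<alpha> \<in> hamming_sphere q n (zero_vertex n) h. g \<alpha> = \<phi> \<alpha>"
  shows "\<forall>\<alpha> \<in> hamming_vertices q n. f \<alpha> = g \<alpha>"
proof
  define d where "d \<alpha> = f \<alpha> - g \<alpha>" for \<alpha>
  define lam where "lam = (real q - 1) * real n - real q * real h"
  have "ev = of_real lam"
    by (simp add: lam_def assms(4))
  then have eigen: "lambda_function q n (of_real lam) d"
    using assms(6,7) by (simp add: lambda_function_def d_def sum_subtractf right_diff_distrib)
  have zero: "d \<alpha> = 0" if "\<alpha> \<in> hamming_vertices q n" "card {i. i < n \<and> \<alpha> i \<noteq> 0} = h" for \<alpha>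
  proof -
    have "{i. i < n \<and> zero_vertex n i \<noteq> \<alpha> i} = {i. i < n \<and> \<alpha> i \<noteq> 0}"
      by (auto simp: zero_vertex_def)
    then have "\<alpha> \<in> hamming_sphere q n (zero_vertex n) h"
      using that by (simp add: hamming_sphere_def hamming_dist_def)
    then show ?thesis
      using assms(8,9) by (simp add: d_def)
  qed
  have "d \<alpha> = 0" if "\<alpha> \<in> hamming_vertices q n" for \<alpha>
    using that
  proof (induction "card {i. i < n \<and> \<alpha> i \<noteq> 0}" arbitrary: \<alpha> rule: less_induct)
    case less
    define I where "I = {i. i < n \<and> \<alpha> i \<noteq> 0}"
    interpret hamming_eigenfunction q n lam d I
      using eigen by unfold_locales (auto simp: I_def)
    have small: "d \<beta> = 0" if "\<beta> \<in> hamming_vertices q n" "card {i. i < n \<and> \<beta> i \<noteq> 0} < card I" for \<beta>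
      using less.hyps[of \<beta>] that by (simp add: I_def)
    show ?case
    proof (cases "card I \<le> h")
      case True
      show ?thesis
      proof (rule vanish_on_support[OF small])
        fix \<beta> assume "\<beta> \<in> hamming_vertices q n" "{i. i < n \<and> \<beta> i \<noteq> 0} = I"
        then show "ksum (\<lambda>i. r_coeff q n h (card I) i (h - card I)) (delta 0) \<beta> = 0"
          using True assms(1,3) by (intro ksum_r_coeff_eq_0) (auto simp: lam_def zero)
      next
        fix l assume "l \<le> card I"
        then show "hamming_eigenvalue (q - 1) (\<lambda>i. r_coeff q n h (card I) i (h - card I)) l (card I) \<noteq> 0"
          using assms(5) True by (simp add: hamming_eigenvalue_def)
      qed (use less.prems I_def in auto)
    next
      case False
      \<comment> \<open>Up to a scalar, x^d is the kernel of the projection to zero sums over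
        alphabet size q: 1 + (q-1) x = 0.\<close>
      let ?x = "- 1 / (real q - 1)"
      show ?thesis
      proof (rule vanish_on_support[OF small])
        fix \<beta> assume "\<beta> \<in> hamming_vertices q n"
        then show "ksum (\<lambda>i. ?x ^ i) (delta 0) \<beta> = 0"
          using False assms(1) by (intro ksum_geometric_eq_0[of _ h]) (auto simp: lam_def)
      next
        fix l assume "l \<le> card I"
        then have "hamming_eigenvalue (q - 1) (\<lambda>i. ?x ^ i) l (card I) =
            (1 - ?x) ^ l * (1 + (real (q - 1) - 1) * ?x) ^ (card I - l)"
          using hamming_eigenvalue_geometric[of l "card I" "q - 1" 1 ?x] by simp
        \<comment> \<open>Over the smaller alphabet of size q - 1 the factors are q/(q-1) and
          1/(q-1), so no eigenvalue vanishes.\<close>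
        moreover have "1 - ?x > 0" "1 + (real (q - 1) - 1) * ?x > 0"
          using assms(1) by (auto simp: field_simps of_nat_diff)
        ultimately show "hamming_eigenvalue (q - 1) (\<lambda>i. ?x ^ i) l (card I) \<noteq> 0"
          using assms(1) by simp
      qed (use less.prems I_def in auto)
    qed
  qed
  then show "f \<alpha> = g \<alpha>" if "\<alpha> \<in> hamming_vertices q n" for \<alpha>
    using that by (simp add: d_def)
qed

end
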